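(* $$g_\alpha(B)\le \frac{d^d}{\alpha^\alpha(d-\alpha)^{d-\alpha}}\,\theta(B)$$ for any $d$-dimensional convex centrally symmetric body $B$ and any positive number $\alpha>\frac d2$.
   Context: A $d$-dimensional convex body is a compact convex set $B\subset\mathbb{R}^d$ with non-empty interior. The number $g_\alpha(B)$ is defined by $$g_\alpha(B)=\inf\left\{\sum_{i=1}^k \lambda_i^\alpha : B\subseteq \bigcup_{i=1}^k(\lambda_i B+x_i),\ \lambda_i\in(0,1),\ x_i\in\mathbb{R}^d\right\},$$ where the infimum is over all finite coverings (any $k$). $\theta(B)$ denotes the smallest density of a covering of the whole space $\mathbb{R}^d$ by translates of $B$. *)

theory Defs
  imports "HOL-Analysis.Analysis"
begin

definition convex_body :: "'a::euclidean_space set \<Rightarrow> bool" where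
  "convex_body B \<longleftrightarrow> compact B \<and> convex B \<and> interior B \<noteq> {}"

(* The centre of symmetry c need not be the origin. *)
definition centrally_symmetric :: "'a::euclidean_space set \<Rightarrow> bool" where
  "centrally_symmetric B \<longleftrightarrow> (\<exists>c. \<forall>x\<in>B. 2 *\<^sub>R c - x \<in> B)"

definition g :: "real \<Rightarrow> 'a::euclidean_space set \<Rightarrow> ennreal" where
  "g \<alpha> B = Inf {ennreal (\<Sum>i<k. l i powr \<alpha>) | (k::nat) (l::nat \<Rightarrow> real) (x::nat \<Rightarrow> 'a).
      (\<forall>i<k. 0 < l i \<and> l i < 1) \<and> B \<subseteq> (\<Union>i<k. (\<lambda>y. l i *\<^sub>R y + x i) ` B)}"

(* Lower density of the system of translates B + a, a in A: the limit inferior as r tends to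
   infinity of the total volume of the translates contained in the ball of radius r about the
   origin, divided by the volume of that ball.  The sum takes values in ennreal, so it is infinite
   if infinitely many translates of a body B lie in the ball. *)
definition lower_density :: "'a::euclidean_space set \<Rightarrow> 'a set \<Rightarrow> ennreal" where
  "lower_density B A =
     Liminf at_top (\<lambda>r::real.
       (\<Sum>\<^sub>\<infinity>a\<in>{a \<in> A. (\<lambda>y. y + a) ` B \<subseteq> cball 0 r}. emeasure lborel ((\<lambda>y. y + a) ` B))
         / emeasure lborel (cball (0::'a) r))"

(* A covering by translates is given by its set of translation vectors; repeating a translate
   could only increase the density. *)
definition covering_density :: "'a::euclidean_space set \<Rightarrow> ennreal" ("\<theta>") where
  "\<theta> B = Inf {lower_density B A | A. (\<Union>a\<in>A. (\<lambda>y. y + a) ` B) = UNIV}"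

(* Real power with 0^0 = 1, whereas 0 powr 0 = 0.  For x < 0 the library's powr gives
   |x| powr y. *)
definition rpow :: "real \<Rightarrow> real \<Rightarrow> real" where
  "rpow x y = (if y = 0 then 1 else x powr y)"

end

theory Submission
  imports Defs
begin

text \<open>
  Let \<open>d\<close> be the dimension and let \<open>0 < l < 1\<close>. Covering \<open>B\<close> by translates of \<open>l B\<close> is the same
  as covering a copy \<open>R B + x\<close>, with \<open>R = 1 / l\<close>, by translates of \<open>B\<close>. A covering of the whole
  space by translates \<open>B + a\<close> provides such a covering for every \<open>x\<close>: keep the translates that
  meet \<open>R B + x\<close>. Since \<open>B\<close> is convex and symmetric, \<open>B + a\<close> meets \<open>R B + x\<close> only for \<open>x\<close> in a
  translate of \<open>(1 + R) B\<close> (\<open>meeting_positions\<close>). Averaged over \<open>x\<close> in a large ball, the number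
  of translates kept is therefore at most about \<open>(1 + R) ^ d\<close> times the density of the covering,
  and some \<open>x\<close> does at least as well as the average
  (\<open>covering_of_scaled_copy_by_few_translates\<close>). Each translate kept contributes \<open>l powr \<alpha>\<close>, so
  \<open>g \<alpha> B\<close> is at most \<open>(1 + 1 / l) ^ d * l powr \<alpha> = (1 + l) ^ d * l powr (\<alpha> - d)\<close> times the
  covering density (\<open>g_le_covering_density\<close>).

  It remains to choose \<open>l\<close>. For \<open>\<alpha> < d\<close> this factor is smallest at \<open>l = (d - \<alpha>) / \<alpha>\<close>, which is
  less than \<open>1\<close> exactly because \<open>\<alpha> > d / 2\<close>, and its value there is the constant of the theorem.
  For \<open>\<alpha> \<ge> d\<close> let \<open>l\<close> tend to \<open>0\<close>: the factor tends to \<open>1\<close> if \<open>\<alpha> = d\<close>, when the constant is \<open>1\<close>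
  too, and to \<open>0\<close> otherwise (\<open>g_le_small_copies\<close>).
\<close>

section \<open>Volumes\<close>

lemma emeasure_lborel_affine_compact:
  fixes B :: "'a::euclidean_space set"
  assumes "compact B"
  shows "emeasure lborel ((\<lambda>y. m *\<^sub>R y + c) ` B) = ennreal (\<bar>m\<bar> ^ DIM('a)) * emeasure lborel B"
proof -
  have "compact ((\<lambda>y. m *\<^sub>R y + c) ` B)"
    using assms by (intro compact_continuous_image continuous_intros)
  hence "emeasure lborel ((\<lambda>y. m *\<^sub>R y + c) ` B) = emeasure lebesgue ((\<lambda>y. m *\<^sub>R y + c) ` B)"
    by (simp add: borel_compact)
  also have "(\<lambda>y. m *\<^sub>R y + c) ` B = (\<lambda>y. c + m *\<^sub>R y) ` B"
    by (simp add: add.commute)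
  also have "emeasure lebesgue \<dots> = ennreal (\<bar>m\<bar> ^ DIM('a)) * emeasure lebesgue B"
    using emeasure_lebesgue_affine[of m c B] by (simp add: ennreal_power add.commute)
  finally show ?thesis
    using assms by (simp add: borel_compact add.commute)
qed

lemma emeasure_lborel_translate_compact:
  fixes B :: "'a::euclidean_space set"
  assumes "compact B"
  shows "emeasure lborel ((\<lambda>y. y + c) ` B) = emeasure lborel B"
  using emeasure_lborel_affine_compact[OF assms, of 1 c] by simp

lemma convex_body_volume:
  fixes B :: "'a::euclidean_space set"
  assumes "convex_body B"
  obtains \<beta> where "\<beta> > 0" "emeasure lborel B = ennreal \<beta>"
proof -
  from assms have "compact B" "interior B \<noteq> {}"
    by (auto simp: convex_body_def)
  then obtain c e where e: "e > 0" "ball c e \<subseteq> B"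
    by (meson all_not_in_conv mem_interior)
  have "0 < emeasure lborel (ball c e)"
    using e by (simp add: emeasure_ball)
  also have "\<dots> \<le> emeasure lborel B"
    using e \<open>compact B\<close> by (intro emeasure_mono) (auto simp: borel_compact)
  finally have "0 < emeasure lborel B" .
  moreover have "emeasure lborel B < \<infinity>"
    using \<open>compact B\<close> by (rule emeasure_compact_finite)
  ultimately show thesis
    by (metis that ennreal_cases ennreal_less_zero_iff infinity_ennreal_def less_irrefl)
qed

section \<open>Translates of a large copy that meet few translates of the body\<close>

text \<open>
  The integral over \<open>C\<close> of the number of sets \<open>T a\<close> through a point is at most the total measure
  of these sets, so that number cannot be at least \<open>m\<close> everywhere on \<open>C\<close>.
\<close>

lemma exists_point_covered_less_often:
  fixes m :: ennreal
  assumes "finite S" and T: "\<And>a. a \<in> S \<Longrightarrow> T a \<in> sets M" and C: "C \<in> sets M"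
    and less: "(\<Sum>a\<in>S. emeasure M (T a)) < m * emeasure M C"
  shows "\<exists>x\<in>C. of_nat (card {a \<in> S. x \<in> T a}) < m"
proof (rule ccontr)
  assume "\<not> ?thesis"
  hence ge: "m \<le> of_nat (card {a \<in> S. x \<in> T a})" if "x \<in> C" for x
    using that by (meson not_le)
  have count: "of_nat (card {a \<in> S. x \<in> T a}) = (\<Sum>a\<in>S. indicator (T a) x :: ennreal)" for x
    using \<open>finite S\<close> by (simp add: indicator_def sum.If_cases Int_def)
  have "m * emeasure M C = (\<integral>\<^sup>+x. m * indicator C x \<partial>M)"
    using C by (simp add: nn_integral_cmult_indicator)
  also have "\<dots> \<le> (\<integral>\<^sup>+x. (\<Sum>a\<in>S. indicator (T a) x) \<partial>M)"
    by (intro nn_integral_mono) (auto simp: indicator_def[of C] ge simp flip: count)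
  also have "\<dots> = (\<Sum>a\<in>S. emeasure M (T a))"
    using T by (simp add: nn_integral_sum)
  finally show False
    using less by simp
qed

text \<open>
  If \<open>B\<close> is symmetric about \<open>c\<close>, then reflecting \<open>B\<close> in \<open>c\<close> turns the difference body of \<open>B\<close> and
  \<open>R B\<close> into a Minkowski sum, and by convexity this sum is a translate of \<open>(1 + R) B\<close>.
  Hence the set of positions \<open>x\<close> at which the copy \<open>R B + x\<close> meets \<open>B + a\<close> has volume at most
  \<open>(1 + R) ^ d\<close> times that of \<open>B\<close>.
\<close>

lemma meeting_positions:
  fixes B :: "'a::euclidean_space set"
  assumes "convex B" and sym: "\<And>x. x \<in> B \<Longrightarrow> 2 *\<^sub>R c - x \<in> B" and "R \<ge> 0"
    and "b \<in> B" "b' \<in> B" and meet: "R *\<^sub>R b + x = b' + a"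
  shows "x \<in> (\<lambda>y. (1 + R) *\<^sub>R y + (a - (2 * R) *\<^sub>R c)) ` B"
proof
  let ?y = "(1 / (1 + R)) *\<^sub>R b' + (R / (1 + R)) *\<^sub>R (2 *\<^sub>R c - b)"
  show "?y \<in> B"
    using \<open>convex B\<close> \<open>b' \<in> B\<close> sym[OF \<open>b \<in> B\<close>] \<open>R \<ge> 0\<close>
    by (intro convexD) (auto simp: field_simps)
  have "(1 + R) *\<^sub>R ?y = b' + R *\<^sub>R (2 *\<^sub>R c - b)"
    using \<open>R \<ge> 0\<close> by (simp add: scaleR_add_right)
  also have "\<dots> = x - (a - (2 * R) *\<^sub>R c)"
    using meet by (simp add: algebra_simps)
  finally show "x = (1 + R) *\<^sub>R ?y + (a - (2 * R) *\<^sub>R c)"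
    by (simp add: algebra_simps)
qed

text \<open>
  The density is only a lower limit, so it is attained approximately on some arbitrarily large
  balls only; one of these suffices. To make sure that each translate that meets \<open>R B + x\<close> is
  counted there, \<open>x\<close> is averaged over a slightly smaller ball; since the radii may be chosen
  large, shrinking the ball costs an arbitrarily small factor.
\<close>

lemma covering_of_scaled_copy_by_few_translates:
  fixes B :: "'a::euclidean_space set"
  assumes B: "convex_body B" "centrally_symmetric B" and "R > 0"
    and cov: "(\<Union>a\<in>A. (\<lambda>y. y + a) ` B) = UNIV"
    and dens: "lower_density B A < t"
  shows "\<exists>F x. finite F \<and> F \<subseteq> A \<and> (\<lambda>y. R *\<^sub>R y + x) ` B \<subseteq> (\<Union>a\<in>F. (\<lambda>y. y + a) ` B) \<and>
           of_nat (card F) < ennreal ((1 + R) ^ DIM('a)) * t"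
proof -
  define d where "d = DIM('a)"
  define \<omega> where "\<omega> = unit_ball_vol (real d)"
  have "\<omega> > 0"
    by (simp add: \<omega>_def)
  have ball: "emeasure lborel (cball (0::'a) r) = ennreal (\<omega> * r ^ d)" if "r \<ge> 0" for r
    using that by (simp add: emeasure_cball \<omega>_def d_def)
  from B have "compact B" "convex B"
    by (auto simp: convex_body_def)
  obtain \<beta> where \<beta>: "\<beta> > 0" "emeasure lborel B = ennreal \<beta>"
    using convex_body_volume B(1) by blast
  obtain c where sym: "\<And>x. x \<in> B \<Longrightarrow> 2 *\<^sub>R c - x \<in> B"
    using B(2) by (auto simp: centrally_symmetric_def)
  obtain b where b: "b > 0" "\<And>y. y \<in> B \<Longrightarrow> norm y \<le> b"
    using compact_imp_bounded[OF \<open>compact B\<close>] by (auto simp: bounded_pos)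
  (* every translate of B that meets R B + x lies in the ball of radius norm x + K about 0 *)
  define K where "K = (R + 2) * b"
  define S where "S r = {a \<in> A. (\<lambda>y. y + a) ` B \<subseteq> cball 0 r}" for r
  define f where
    "f r = (\<Sum>\<^sub>\<infinity>a\<in>S r. emeasure lborel ((\<lambda>y. y + a) ` B)) / emeasure lborel (cball (0::'a) r)" for r
  have f: "f r = (\<Sum>\<^sub>\<infinity>a\<in>S r. ennreal \<beta>) / emeasure lborel (cball (0::'a) r)" for r
    unfolding f_def by (simp add: emeasure_lborel_translate_compact[OF \<open>compact B\<close>] \<beta>)

  (* u bounds the density on the chosen ball; the gap from u to v pays for shrinking the ball *)
  obtain v where v: "lower_density B A < v" "v < t"
    using dens dense by blast
  obtain u where u: "lower_density B A < u" "u < v"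
    using v dense by blast
  obtain v' where v': "v = ennreal v'" "v' \<ge> 0"
    using v by (cases v) auto
  obtain u' where u': "u = ennreal u'" "u' \<ge> 0"
    using u by (cases u) auto
  have "u' < v'"
    using u u' v' by (simp add: ennreal_less_iff)

  have "\<exists>\<^sub>F r in at_top. f r < u"
  proof (rule ccontr)
    assume "\<not> ?thesis"
    hence "\<forall>\<^sub>F r in at_top. u \<le> f r"
      by (simp add: frequently_def not_less)
    hence "u \<le> Liminf at_top f"
      by (rule Liminf_bounded)
    thus False
      using u(1) unfolding lower_density_def f_def S_def by simp
  qed
  moreover have "\<forall>\<^sub>F r in at_top. u' * r ^ d < v' * (r - K) ^ d \<and> r > K \<and> r > 0"
  proof -
    have "((\<lambda>r. v' * (1 - K / r) ^ d) \<longlongrightarrow> v' * (1 - 0) ^ d) at_top"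
      by (intro tendsto_intros tendsto_divide_0[OF tendsto_const]
          filterlim_at_top_imp_at_infinity filterlim_ident)
    hence "\<forall>\<^sub>F r in at_top. u' < v' * (1 - K / r) ^ d"
      using \<open>u' < v'\<close> by (intro order_tendstoD(1)) auto
    moreover have "\<forall>\<^sub>F r in at_top. r > K" "\<forall>\<^sub>F r::real in at_top. r > 0"
      by (rule eventually_gt_at_top)+
    ultimately show ?thesis
    proof eventually_elim
      case (elim r)
      have "u' * r ^ d < v' * (1 - K / r) ^ d * r ^ d"
        using elim by (intro mult_strict_right_mono) auto
      also have "\<dots> = v' * ((1 - K / r) * r) ^ d"
        by (simp only: power_mult_distrib mult.assoc)
      also have "(1 - K / r) * r = r - K"
        using elim by (simp add: field_simps)
      finally show ?case
        using elim by simp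
    qed
  qed
  ultimately have "\<exists>\<^sub>F r in at_top. f r < u \<and> u' * r ^ d < v' * (r - K) ^ d \<and> r > K \<and> r > 0"
    using frequently_eventually_conj by (fastforce elim: frequently_elim1)
  then obtain r where r: "f r < u" "u' * r ^ d < v' * (r - K) ^ d" "r > K" "r > 0"
    using frequently_ex by blast

  have "ennreal (\<omega> * r ^ d) \<noteq> 0"
    using \<open>\<omega> > 0\<close> \<open>r > 0\<close> by simp
  hence sum_less: "(\<Sum>\<^sub>\<infinity>a\<in>S r. ennreal \<beta>) < u * ennreal (\<omega> * r ^ d)"
    using r(1,4) unfolding f by (simp add: ball divide_less_ennreal)
  have fin: "finite (S r)"
  proof (rule ccontr)
    assume "infinite (S r)"
    hence "(\<Sum>\<^sub>\<infinity>a\<in>S r. ennreal \<beta>) = \<infinity>"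
      using \<beta> by (intro infsum_superconst_infinite_ennreal[of _ "ennreal \<beta>"]) auto
    thus False
      using sum_less by simp
  qed
  have "ennreal (card (S r) * \<beta>) < ennreal (u' * (\<omega> * r ^ d))"
    using sum_less fin u' by (simp add: ennreal_of_nat_eq_real_of_nat ennreal_mult')
  hence "card (S r) * \<beta> < u' * (\<omega> * r ^ d)"
    using \<beta> by (simp add: ennreal_less_iff)
  also have "\<dots> = \<omega> * (u' * r ^ d)"
    by simp
  also have "\<dots> < \<omega> * (v' * (r - K) ^ d)"
    using r \<open>\<omega> > 0\<close> by (intro mult_strict_left_mono)
  finally have card_less: "card (S r) * \<beta> < \<omega> * (v' * (r - K) ^ d)" .

  define T where "T a = (\<lambda>y. (1 + R) *\<^sub>R y + (a - (2 * R) *\<^sub>R c)) ` B" for a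
  have T: "compact (T a)" for a
    unfolding T_def using \<open>compact B\<close> by (intro compact_continuous_image continuous_intros)
  have vol_T: "emeasure lborel (T a) = ennreal ((1 + R) ^ d * \<beta>)" for a
    unfolding T_def using \<open>R > 0\<close> \<beta>
    by (simp add: emeasure_lborel_affine_compact[OF \<open>compact B\<close>] d_def ennreal_mult')
  have "(\<Sum>a\<in>S r. emeasure lborel (T a)) = ennreal ((1 + R) ^ d * (card (S r) * \<beta>))"
    using \<open>R > 0\<close> \<beta>
    by (simp add: vol_T ennreal_of_nat_eq_real_of_nat mult_ac flip: ennreal_mult')
  also have "\<dots> < ennreal ((1 + R) ^ d * (\<omega> * (v' * (r - K) ^ d)))"
  proof (rule ennreal_lessI)
    have "0 \<le> card (S r) * \<beta>"
      using \<beta> by simp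
    also note card_less
    finally show "0 < (1 + R) ^ d * (\<omega> * (v' * (r - K) ^ d))"
      using \<open>R > 0\<close> by (simp only: zero_less_mult_iff[of "(1 + R) ^ d"]) simp
    show "(1 + R) ^ d * (card (S r) * \<beta>) < (1 + R) ^ d * (\<omega> * (v' * (r - K) ^ d))"
      using card_less \<open>R > 0\<close> by (intro mult_strict_left_mono) auto
  qed
  also have "\<dots> = ennreal ((1 + R) ^ d) * v * emeasure lborel (cball (0::'a) (r - K))"
    using r \<open>\<omega> > 0\<close> \<open>R > 0\<close> v' by (simp add: ball mult_ac flip: ennreal_mult')
  finally obtain x where x: "x \<in> cball 0 (r - K)"
      "of_nat (card {a \<in> S r. x \<in> T a}) < ennreal ((1 + R) ^ d) * v"
    using exists_point_covered_less_often[OF fin, of T lborel "cball 0 (r - K)"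
        "ennreal ((1 + R) ^ d) * v"] T
    by (auto simp: borel_compact)

  have "(\<lambda>y. R *\<^sub>R y + x) ` B \<subseteq> (\<Union>a\<in>{a \<in> S r. x \<in> T a}. (\<lambda>y. y + a) ` B)"
  proof
    fix z
    assume "z \<in> (\<lambda>y. R *\<^sub>R y + x) ` B"
    then obtain y where y: "y \<in> B" "z = R *\<^sub>R y + x"
      by auto
    have "z \<in> (\<Union>a\<in>A. (\<lambda>y. y + a) ` B)"
      using cov by simp
    then obtain a w where a: "a \<in> A" "w \<in> B" "z = w + a"
      by auto
    have "x \<in> T a"
      unfolding T_def using meeting_positions[of B c R y w x a] \<open>convex B\<close> sym \<open>R > 0\<close> y a by auto
    moreover have "(\<lambda>y. y + a) ` B \<subseteq> cball 0 r"
    proof clarify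
      fix p assume "p \<in> B"
      have "p + a = p + (R *\<^sub>R y + x - w)"
        using a y by simp
      also have "norm \<dots> \<le> norm p + (norm (R *\<^sub>R y) + norm x + norm w)"
      proof -
        have "norm (p + (q + x - w)) \<le> norm p + (norm q + norm x + norm w)" for q
          by norm
        thus ?thesis .
      qed
      also have "norm (R *\<^sub>R y) \<le> R * b"
        using b(2)[OF y(1)] \<open>R > 0\<close> by simp
      also have "norm p + (R * b + norm x + norm w) \<le> b + (R * b + (r - K) + b)"
        using b(2)[OF \<open>p \<in> B\<close>] b(2)[OF a(2)] x(1) by simp
      also have "\<dots> = r"
        by (simp add: K_def algebra_simps)
      finally show "p + a \<in> cball 0 r"
        by simp
    qed
    ultimately show "z \<in> (\<Union>a\<in>{a \<in> S r. x \<in> T a}. (\<lambda>y. y + a) ` B)"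
      using a by (auto simp: S_def)
  qed
  moreover have "ennreal ((1 + R) ^ d) * v \<le> ennreal ((1 + R) ^ d) * t"
    using v by (intro mult_left_mono) auto
  moreover have "finite {a \<in> S r. x \<in> T a}" "{a \<in> S r. x \<in> T a} \<subseteq> A"
    using fin finite_subset[of "{a \<in> S r. x \<in> T a}" "S r"] by (auto simp only: S_def)
  ultimately show ?thesis
    using x(2) unfolding d_def by (meson less_le_trans)
qed

section \<open>Coverings of the body by homothetic copies of one size\<close>

lemma g_le_card:
  fixes B :: "'a::euclidean_space set" and \<alpha> :: real
  assumes "finite F" and l: "0 < l" "l < 1"
    and cov: "B \<subseteq> (\<Union>x\<in>F. (\<lambda>y. l *\<^sub>R y + x) ` B)"
  shows "g \<alpha> B \<le> ennreal (real (card F) * l powr \<alpha>)"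
proof -
  obtain h where h: "bij_betw h {..<card F} F"
    using ex_bij_betw_nat_finite[OF \<open>finite F\<close>] by (auto simp: lessThan_atLeast0)
  have "B \<subseteq> (\<Union>i<card F. (\<lambda>y. l *\<^sub>R y + h i) ` B)"
    using cov h by (force simp: bij_betw_def)
  thus ?thesis
    unfolding g_def using l
    by (intro Inf_lower CollectI exI[of _ "card F"] exI[of _ "\<lambda>_. l"] exI[of _ h]) auto
qed

text \<open>
  Scaling a covering of \<open>(1 / l) B + x\<close> by translates of \<open>B\<close> down by the factor \<open>l\<close> gives a
  covering of \<open>B\<close> by translates of \<open>l B\<close>.
\<close>

lemma g_le_lower_density:
  fixes B :: "'a::euclidean_space set" and \<alpha> :: real
  assumes B: "convex_body B" "centrally_symmetric B" and l: "0 < l" "l < 1"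
    and cov: "(\<Union>a\<in>A. (\<lambda>y. y + a) ` B) = UNIV"
  shows "g \<alpha> B \<le> ennreal ((1 + l) ^ DIM('a) * l powr (\<alpha> - DIM('a))) * lower_density B A"
proof -
  define k where "k = (1 + l) ^ DIM('a) * l powr (\<alpha> - DIM('a))"
  have "k > 0"
    using l by (simp add: k_def)
  have k: "k = l powr \<alpha> * (1 + 1 / l) ^ DIM('a)"
  proof -
    have "1 + 1 / l = (1 + l) / l"
      using l by (simp add: field_simps)
    thus ?thesis
      using l by (simp add: k_def powr_diff powr_realpow power_divide)
  qed
  have le: "g \<alpha> B \<le> ennreal k * t" if t: "lower_density B A < t" for t
  proof -
    obtain F x where F: "finite F" "(\<lambda>y. (1 / l) *\<^sub>R y + x) ` B \<subseteq> (\<Union>a\<in>F. (\<lambda>y. y + a) ` B)"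
        "of_nat (card F) < ennreal ((1 + 1 / l) ^ DIM('a)) * t"
      using covering_of_scaled_copy_by_few_translates[OF B, of "1 / l" A t] l cov t by auto
    have "B \<subseteq> (\<Union>a\<in>(\<lambda>a. l *\<^sub>R (a - x)) ` F. (\<lambda>y. l *\<^sub>R y + a) ` B)"
    proof
      fix y assume "y \<in> B"
      then obtain a w where a: "a \<in> F" "w \<in> B" "(1 / l) *\<^sub>R y + x = w + a"
        using F(2) by blast
      have "y = l *\<^sub>R ((1 / l) *\<^sub>R y)"
        using l by simp
      also have "(1 / l) *\<^sub>R y = w + (a - x)"
        using a(3) by (simp add: algebra_simps)
      finally have "y = l *\<^sub>R w + l *\<^sub>R (a - x)"
        by (simp add: scaleR_add_right)
      thus "y \<in> (\<Union>a\<in>(\<lambda>a. l *\<^sub>R (a - x)) ` F. (\<lambda>y. l *\<^sub>R y + a) ` B)"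
        using a by blast
    qed
    hence "g \<alpha> B \<le> ennreal (real (card ((\<lambda>a. l *\<^sub>R (a - x)) ` F)) * l powr \<alpha>)"
      using F l by (intro g_le_card) auto
    also have "\<dots> \<le> ennreal (real (card F) * l powr \<alpha>)"
      using F(1) by (intro ennreal_leI mult_right_mono) (auto simp: card_image_le)
    also have "\<dots> = ennreal (l powr \<alpha>) * of_nat (card F)"
      by (simp add: ennreal_of_nat_eq_real_of_nat ennreal_mult' mult.commute)
    also have "\<dots> \<le> ennreal (l powr \<alpha>) * (ennreal ((1 + 1 / l) ^ DIM('a)) * t)"
      using F(3) by (intro mult_left_mono) auto
    also have "\<dots> = ennreal k * t"
      using l by (simp add: k ennreal_mult mult.assoc)
    finally show ?thesis .
  qed
  show ?thesis
  proof (cases "lower_density B A")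
    case (real L)
    have "((\<lambda>s. ennreal (k * s)) \<longlongrightarrow> ennreal (k * L)) (at_right L)"
      by (intro tendsto_intros)
    moreover have "\<forall>\<^sub>F s in at_right L. g \<alpha> B \<le> ennreal (k * s)"
      using eventually_at_right_less[of L]
    proof eventually_elim
      case (elim s)
      thus ?case
        using le[of "ennreal s"] real \<open>k > 0\<close> by (simp add: ennreal_less_iff ennreal_mult')
    qed
    ultimately have "g \<alpha> B \<le> ennreal (k * L)"
      by (intro tendsto_lowerbound) auto
    thus ?thesis
      using real \<open>k > 0\<close> by (simp add: k_def[symmetric] ennreal_mult')
  next
    case top
    thus ?thesis
      using \<open>k > 0\<close> by (simp add: k_def[symmetric] ennreal_mult_top)
  qed
qed

lemma g_le_covering_density:
  fixes B :: "'a::euclidean_space set" and \<alpha> :: real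
  assumes B: "convex_body B" "centrally_symmetric B" and l: "0 < l" "l < 1"
  shows "g \<alpha> B \<le> ennreal ((1 + l) ^ DIM('a) * l powr (\<alpha> - DIM('a))) * \<theta> B"
proof -
  define k where "k = ennreal ((1 + l) ^ DIM('a) * l powr (\<alpha> - DIM('a)))"
  have k: "k \<noteq> 0" "k \<noteq> top"
    using l by (auto simp: k_def)
  hence cancel: "k * z / k = z" for z
    using mult_divide_eq_ennreal[of k z] by (simp add: mult.commute)
  have "g \<alpha> B / k \<le> \<theta> B"
    unfolding covering_density_def
  proof (rule Inf_greatest, clarify)
    fix A assume "(\<Union>a\<in>A. (\<lambda>y. y + a) ` B) = UNIV"
    from g_le_lower_density[OF B l this, of \<alpha>]
    have "g \<alpha> B / k \<le> k * lower_density B A / k"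
      unfolding k_def by (rule divide_right_mono_ennreal)
    also note cancel
    finally show "g \<alpha> B / k \<le> lower_density B A" .
  qed
  hence "k * (g \<alpha> B / k) \<le> k * \<theta> B"
    by (intro mult_left_mono) auto
  also have "k * (g \<alpha> B / k) = g \<alpha> B"
    by (simp add: ennreal_times_divide cancel)
  finally show ?thesis
    unfolding k_def .
qed

section \<open>The choice of the ratio\<close>

text \<open>
  When \<open>\<alpha> \<ge> d\<close>, no positive \<open>l\<close> minimises the factor in \<open>g_le_covering_density\<close>;
  it tends to \<open>1\<close> for \<open>\<alpha> = d\<close> and to \<open>0\<close> for \<open>\<alpha> > d\<close> as \<open>l\<close> tends to \<open>0\<close>.
\<close>

lemma g_le_small_copies:
  fixes B :: "'a::euclidean_space set" and \<alpha> :: real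
  assumes B: "convex_body B" "centrally_symmetric B"
    and "\<alpha> \<ge> DIM('a)" and "C > 0" and C: "\<alpha> = DIM('a) \<Longrightarrow> C \<ge> 1"
  shows "g \<alpha> B \<le> ennreal C * \<theta> B"
proof (cases "\<theta> B")
  case (real v)
  define k where "k l = (1 + l) ^ DIM('a) * l powr (\<alpha> - DIM('a))" for l :: real
  define k0 :: real where "k0 = (if \<alpha> = DIM('a) then 1 else 0)"
  have small: "\<forall>\<^sub>F l::real in at_right 0. 0 < l \<and> l < 1"
    by (auto simp: eventually_at_right_field intro: exI[of _ 1])
  have "(k \<longlongrightarrow> k0) (at_right 0)"
  proof (cases "\<alpha> = DIM('a)")
    case True
    have "((\<lambda>l::real. (1 + l) ^ DIM('a)) \<longlongrightarrow> (1 + 0) ^ DIM('a)) (at_right 0)"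
      by (intro tendsto_intros)
    moreover have "\<forall>\<^sub>F l in at_right 0. (1 + l) ^ DIM('a) = k l"
      using small by eventually_elim (simp add: k_def True)
    ultimately show ?thesis
      using True by (simp add: k0_def tendsto_cong)
  next
    case False
    have "(k \<longlongrightarrow> (1 + 0) ^ DIM('a) * 0) (at_right 0)"
      unfolding k_def using False \<open>\<alpha> \<ge> DIM('a)\<close>
      by (intro tendsto_intros tendsto_mult)
         (auto intro!: tendsto_eq_intros gt_ex simp: eventually_at_right_field)
    thus ?thesis
      using False by (simp add: k0_def)
  qed
  hence "((\<lambda>l. ennreal (k l * v)) \<longlongrightarrow> ennreal (k0 * v)) (at_right 0)"
    by (intro tendsto_intros)
  moreover have "\<forall>\<^sub>F l in at_right 0. g \<alpha> B \<le> ennreal (k l * v)"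
    using small
  proof eventually_elim
    case (elim l)
    thus ?case
      using g_le_covering_density[OF B, of l \<alpha>] real by (simp add: k_def ennreal_mult')
  qed
  ultimately have "g \<alpha> B \<le> ennreal (k0 * v)"
    by (intro tendsto_lowerbound) auto
  also have "\<dots> \<le> ennreal (C * v)"
    using real C \<open>C > 0\<close> by (intro ennreal_leI mult_right_mono) (auto simp: k0_def)
  also have "\<dots> = ennreal C * \<theta> B"
    using real \<open>C > 0\<close> by (simp add: ennreal_mult')
  finally show ?thesis .
next
  case top
  thus ?thesis
    using \<open>C > 0\<close> by (simp add: ennreal_mult_top)
qed

theorem theorem7:
  fixes B :: "'a::euclidean_space set" and \<alpha> :: real
  assumes "convex_body B" and "centrally_symmetric B"
    and "\<alpha> > 0" and "\<alpha> > real DIM('a) / 2"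
  shows "g \<alpha> B \<le> ennreal (real DIM('a) ^ DIM('a) /
           (\<alpha> powr \<alpha> * rpow (real DIM('a) - \<alpha>) (real DIM('a) - \<alpha>))) * \<theta> B"
proof (cases "\<alpha> < DIM('a)")
  case True
  define d where "d = real DIM('a)"
  (* the minimiser of (1 + l) ^ d * l powr (\<alpha> - d); it is below 1 because \<alpha> > d / 2 *)
  define l where "l = (d - \<alpha>) / \<alpha>"
  have "\<alpha> > 0" "\<alpha> < d" "\<alpha> > d / 2"
    using assms True by (simp_all add: d_def)
  have l: "0 < l" "l < 1"
    using \<open>\<alpha> > 0\<close> \<open>\<alpha> < d\<close> \<open>\<alpha> > d / 2\<close> by (simp_all add: l_def field_simps)
  have "1 + l = d / \<alpha>"
    using \<open>\<alpha> > 0\<close> by (simp add: l_def field_simps)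
  hence "(1 + l) ^ DIM('a) * l powr (\<alpha> - d) = (d / \<alpha>) ^ DIM('a) * ((d - \<alpha>) / \<alpha>) powr (\<alpha> - d)"
    by (simp add: l_def)
  also have "\<dots> = d ^ DIM('a) / \<alpha> powr d * ((d - \<alpha>) powr (\<alpha> - d) / \<alpha> powr (\<alpha> - d))"
    using \<open>\<alpha> > 0\<close> \<open>\<alpha> < d\<close> by (simp add: power_divide powr_divide powr_realpow d_def)
  also have "\<dots> = d ^ DIM('a) * (d - \<alpha>) powr (\<alpha> - d) / (\<alpha> powr d * \<alpha> powr (\<alpha> - d))"
    by simp
  also have "\<alpha> powr d * \<alpha> powr (\<alpha> - d) = \<alpha> powr \<alpha>"
    by (simp flip: powr_add)
  also have "(d - \<alpha>) powr (\<alpha> - d) = 1 / (d - \<alpha>) powr (d - \<alpha>)"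
    using powr_minus_divide[of "d - \<alpha>" "d - \<alpha>"] by simp
  finally have "(1 + l) ^ DIM('a) * l powr (\<alpha> - d) =
      d ^ DIM('a) / (\<alpha> powr \<alpha> * rpow (d - \<alpha>) (d - \<alpha>))"
    using \<open>\<alpha> < d\<close> by (simp add: rpow_def mult.commute)
  thus ?thesis
    using g_le_covering_density[OF assms(1,2) l, of \<alpha>] by (simp add: d_def)
next
  case False
  show ?thesis
    using assms False by (intro g_le_small_copies) (auto simp: rpow_def powr_realpow)
qed

end
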